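(* Let $a\ge0$ and let $\mathcal H=\ell_2^2(\mathbb N)=\mathbb R^2\oplus\mathbb R^2\oplus\cdots$. For every function $F:\mathbb R_+\to(0,1)$ that strictly decreases to zero, there is a point $z^0\in\mathcal H$ and two closed subspaces $U,V\subseteq\mathcal H$ with $U\cap V=\{0\}$ such that the following holds. Let $f=\iota_U+\frac a2\|\cdot\|^2$, $g=\iota_V$, $h=\frac12\|\cdot\|^2$, $A=\partial f$, $B=\partial g$, $C=\nabla h$, $\gamma=1$, let $$T:=I_{\mathcal H}-J_{\gamma B}+J_{\gamma A}\circ(2J_{\gamma B}-I_{\mathcal H}-\gamma C\circ J_{\gamma B}),$$ and let $z^{k+1}=Tz^k$ for all $k\ge0$ (relaxation parameters $\lambda_k\equiv1$). Then, with $z^\ast=0$ the fixed point of $T$, $$\|z^k-z^\ast\|\ge e^{-1}F(k)\quad\text{for all }k\ge0,$$ but $(\|z^j-z^\ast\|)_{j\ge0}$ converges to $0$.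
   Context: $\ell_2^2(\mathbb N)$ is the Hilbert space of square-summable sequences of vectors in $\mathbb R^2$. $\iota_U$ is the indicator function ($0$ on $U$, $+\infty$ off $U$), $\partial$ the convex subdifferential, and $J_S:=(I_{\mathcal H}+S)^{-1}$ the resolvent. *)

theory Defs
  imports "HOL-Analysis.Analysis"
begin

section \<open>The Hilbert space of square-summable sequences in the plane\<close>

lemma summable_inner_of_square_summable:
  fixes x y :: "nat \<Rightarrow> 'a::real_inner"
  assumes "summable (\<lambda>n. (norm (x n))\<^sup>2)" "summable (\<lambda>n. (norm (y n))\<^sup>2)"
  shows "summable (\<lambda>n. x n \<bullet> y n)"
proof (rule summable_comparison_test')
  show "summable (\<lambda>n. (norm (x n))\<^sup>2 + (norm (y n))\<^sup>2)"
    using assms by (rule summable_add)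
  fix n
  have "2 * (norm (x n) * norm (y n)) \<le> (norm (x n))\<^sup>2 + (norm (y n))\<^sup>2"
    using sum_squares_bound[of "norm (x n)" "norm (y n)"] by simp
  moreover have "0 \<le> norm (x n) * norm (y n)" by simp
  ultimately show "norm (x n \<bullet> y n) \<le> (norm (x n))\<^sup>2 + (norm (y n))\<^sup>2"
    using Cauchy_Schwarz_ineq2[of "x n" "y n"] unfolding real_norm_def by linarith
qed

lemma square_summable_add:
  fixes x y :: "nat \<Rightarrow> 'a::real_inner"
  assumes "summable (\<lambda>n. (norm (x n))\<^sup>2)" "summable (\<lambda>n. (norm (y n))\<^sup>2)"
  shows "summable (\<lambda>n. (norm (x n + y n))\<^sup>2)"
proof -
  have eq: "(norm (x n + y n))\<^sup>2 = (norm (x n))\<^sup>2 + (norm (y n))\<^sup>2 + 2 * (x n \<bullet> y n)" for n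
    by (simp add: power2_norm_eq_inner inner_add_left inner_add_right inner_commute)
  show ?thesis
    unfolding eq
    by (intro summable_add summable_mult assms summable_inner_of_square_summable)
qed

typedef ell22 = "{x :: nat \<Rightarrow> real^2. summable (\<lambda>n. (norm (x n))\<^sup>2)}"
  morphisms entry Abs_ell22
  by (rule exI[of _ "\<lambda>_. 0"]) simp

setup_lifting type_definition_ell22

instantiation ell22 :: real_vector
begin

lift_definition zero_ell22 :: ell22 is "\<lambda>_. 0" by simp

lift_definition plus_ell22 :: "ell22 \<Rightarrow> ell22 \<Rightarrow> ell22" is "\<lambda>x y n. x n + y n"
  by (rule square_summable_add)

lift_definition uminus_ell22 :: "ell22 \<Rightarrow> ell22" is "\<lambda>x n. - x n" by simp

lift_definition minus_ell22 :: "ell22 \<Rightarrow> ell22 \<Rightarrow> ell22" is "\<lambda>x y n. x n - y n"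
proof -
  fix x y :: "nat \<Rightarrow> real^2"
  assume "summable (\<lambda>n. (norm (x n))\<^sup>2)" "summable (\<lambda>n. (norm (y n))\<^sup>2)"
  then show "summable (\<lambda>n. (norm (x n - y n))\<^sup>2)"
    using square_summable_add[of x "\<lambda>n. - y n"] by simp
qed

lift_definition scaleR_ell22 :: "real \<Rightarrow> ell22 \<Rightarrow> ell22" is "\<lambda>r x n. r *\<^sub>R x n"
  by (simp add: power_mult_distrib)

instance
  by standard (transfer; simp add: algebra_simps fun_eq_iff)+

end

instantiation ell22 :: real_inner
begin

lift_definition inner_ell22 :: "ell22 \<Rightarrow> ell22 \<Rightarrow> real" is "\<lambda>x y. \<Sum>n. x n \<bullet> y n" .

definition norm_ell22 :: "ell22 \<Rightarrow> real" where "norm_ell22 x = sqrt (x \<bullet> x)"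

definition dist_ell22 :: "ell22 \<Rightarrow> ell22 \<Rightarrow> real" where "dist_ell22 x y = norm (x - y)"

definition sgn_ell22 :: "ell22 \<Rightarrow> ell22" where "sgn_ell22 x = x /\<^sub>R norm x"

definition uniformity_ell22 :: "(ell22 \<times> ell22) filter" where
  "uniformity_ell22 = (INF e\<in>{0<..}. principal {(x, y). dist x y < e})"

definition open_ell22 :: "ell22 set \<Rightarrow> bool" where
  "open_ell22 U = (\<forall>x\<in>U. \<forall>\<^sub>F (x', y) in uniformity. x' = x \<longrightarrow> y \<in> U)"

instance
proof
  fix x y z :: ell22 and r :: real
  show "dist x y = norm (x - y)" by (rule dist_ell22_def)
  show "sgn x = x /\<^sub>R norm x" by (rule sgn_ell22_def)
  show "(uniformity :: (ell22 \<times> ell22) filter) = (INF e\<in>{0<..}. principal {(x, y). dist x y < e})"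
    by (rule uniformity_ell22_def)
  show "open U = (\<forall>x\<in>U. \<forall>\<^sub>F (x', y) in uniformity. x' = x \<longrightarrow> y \<in> U)" for U :: "ell22 set"
    by (rule open_ell22_def)
  show "x \<bullet> y = y \<bullet> x"
    by transfer (simp add: inner_commute)
  show "(x + y) \<bullet> z = x \<bullet> z + y \<bullet> z"
    by transfer (simp add: inner_add_left suminf_add summable_inner_of_square_summable)
  show "(r *\<^sub>R x) \<bullet> y = r * (x \<bullet> y)"
    by transfer (simp add: suminf_mult summable_inner_of_square_summable)
  show "0 \<le> x \<bullet> x"
    by transfer (simp add: suminf_nonneg summable_inner_of_square_summable)
  show "x \<bullet> x = 0 \<longleftrightarrow> x = 0"
    by transfer (simp add: suminf_eq_zero_iff summable_inner_of_square_summable fun_eq_iff)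
  show "norm x = sqrt (x \<bullet> x)" by (rule norm_ell22_def)
qed

end

lemma summable_entry: "summable (\<lambda>n. (norm (entry x n))\<^sup>2)"
  using entry[of x] by simp

lemma norm_ell22_eq: "(norm x)\<^sup>2 = (\<Sum>n. (norm (entry x n))\<^sup>2)"
  by (simp only: power2_norm_eq_inner inner_ell22.rep_eq)

lemma sum_entry_le: "(\<Sum>n<K. (norm (entry x n))\<^sup>2) \<le> (norm x)\<^sup>2"
  unfolding norm_ell22_eq by (intro sum_le_suminf summable_entry) auto

lemma norm_entry_le: "norm (entry x n) \<le> norm x"
proof -
  have "(norm (entry x n))\<^sup>2 \<le> (\<Sum>i<Suc n. (norm (entry x i))\<^sup>2)"
    by (simp add: sum_nonneg)
  also have "\<dots> \<le> (norm x)\<^sup>2" by (rule sum_entry_le)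
  finally show ?thesis by (rule power2_le_imp_le) simp
qed

instance ell22 :: complete_space
proof
  fix X :: "nat \<Rightarrow> ell22"
  assume X: "Cauchy X"
  have "Cauchy (\<lambda>m. entry (X m) n)" for n
  proof (rule metric_CauchyI)
    fix e :: real assume "0 < e"
    then obtain N where N: "\<And>m k. m \<ge> N \<Longrightarrow> k \<ge> N \<Longrightarrow> dist (X m) (X k) < e"
      using metric_CauchyD[OF X] by meson
    have "dist (entry (X m) n) (entry (X k) n) < e" if "m \<ge> N" "k \<ge> N" for m k
      using N[OF that] norm_entry_le[of "X m - X k" n]
      by (simp add: dist_norm minus_ell22.rep_eq)
    then show "\<exists>M. \<forall>m\<ge>M. \<forall>k\<ge>M. dist (entry (X m) n) (entry (X k) n) < e" by blast
  qed
  then have "\<exists>l. (\<lambda>m. entry (X m) n) \<longlonglongrightarrow> l" for n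
    using Cauchy_convergent convergent_def by blast
  then obtain L where L: "\<And>n. (\<lambda>m. entry (X m) n) \<longlonglongrightarrow> L n" by metis
  have bound: "\<exists>N. \<forall>m\<ge>N. \<forall>K. (\<Sum>n<K. (norm (entry (X m) n - L n))\<^sup>2) \<le> e\<^sup>2"
    if "0 < e" for e
  proof -
    obtain N where N: "\<And>m k. m \<ge> N \<Longrightarrow> k \<ge> N \<Longrightarrow> dist (X m) (X k) < e"
      using metric_CauchyD[OF X \<open>0 < e\<close>] by meson
    have "(\<Sum>n<K. (norm (entry (X m) n - L n))\<^sup>2) \<le> e\<^sup>2" if m: "m \<ge> N" for m K
    proof (rule LIMSEQ_le_const2)
      show "(\<lambda>k. \<Sum>n<K. (norm (entry (X m) n - entry (X k) n))\<^sup>2)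
              \<longlonglongrightarrow> (\<Sum>n<K. (norm (entry (X m) n - L n))\<^sup>2)"
        by (intro tendsto_intros L)
      have "(\<Sum>n<K. (norm (entry (X m) n - entry (X k) n))\<^sup>2) \<le> e\<^sup>2" if "k \<ge> N" for k
      proof -
        have "(\<Sum>n<K. (norm (entry (X m) n - entry (X k) n))\<^sup>2) \<le> (norm (X m - X k))\<^sup>2"
          using sum_entry_le[where K = K and x = "X m - X k"] by (simp add: minus_ell22.rep_eq)
        also have "\<dots> \<le> e\<^sup>2"
          using N[OF m that] by (intro power_mono) (auto simp: dist_norm)
        finally show ?thesis .
      qed
      then show "\<exists>M. \<forall>k\<ge>M. (\<Sum>n<K. (norm (entry (X m) n - entry (X k) n))\<^sup>2) \<le> e\<^sup>2"
        by blast
    qed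
    then show ?thesis by blast
  qed
  have diff: "summable (\<lambda>n. (norm (entry (X m) n - L n))\<^sup>2)"
    if "\<And>K. (\<Sum>n<K. (norm (entry (X m) n - L n))\<^sup>2) \<le> e\<^sup>2" for m e
    using that by (intro summableI_nonneg_bounded[where x = "e\<^sup>2"]) auto
  obtain m where "\<And>K. (\<Sum>n<K. (norm (entry (X m) n - L n))\<^sup>2) \<le> 1\<^sup>2"
    using bound[of 1] by auto
  then have "summable (\<lambda>n. (norm (L n - entry (X m) n))\<^sup>2)"
    using diff[of m 1] by (simp add: norm_minus_commute)
  then have "summable (\<lambda>n. (norm (L n))\<^sup>2)"
    using square_summable_add[of "\<lambda>n. L n - entry (X m) n" "entry (X m)"] summable_entry[of "X m"]
    by simp
  then have entryL: "entry (Abs_ell22 L) = L" by (simp add: Abs_ell22_inverse)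
  have "X \<longlonglongrightarrow> Abs_ell22 L"
  proof (rule metric_LIMSEQ_I)
    fix e :: real assume "0 < e"
    then obtain N where N: "\<And>m K. m \<ge> N \<Longrightarrow>
        (\<Sum>n<K. (norm (entry (X m) n - L n))\<^sup>2) \<le> (e / 2)\<^sup>2"
      using bound[of "e / 2"] by auto
    have "dist (X m) (Abs_ell22 L) < e" if "m \<ge> N" for m
    proof -
      have "(norm (X m - Abs_ell22 L))\<^sup>2 \<le> (e / 2)\<^sup>2"
        unfolding norm_ell22_eq minus_ell22.rep_eq entryL
        by (intro suminf_le_const diff[of m "e / 2"] N that)
      then have "norm (X m - Abs_ell22 L) \<le> e / 2"
        by (rule power2_le_imp_le) (use \<open>0 < e\<close> in simp)
      with \<open>0 < e\<close> show ?thesis by (simp add: dist_norm)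
    qed
    then show "\<exists>N. \<forall>m\<ge>N. dist (X m) (Abs_ell22 L) < e" by blast
  qed
  then show "convergent X" by (rule convergentI)
qed

section \<open>Convex analysis and three-operator splitting\<close>

text \<open>Set-valued operators on \<open>'a\<close> are functions of type \<open>'a \<Rightarrow> 'a set\<close>.\<close>

definition convex_indicator :: "'a set \<Rightarrow> 'a \<Rightarrow> ereal" where
  "convex_indicator U x = (if x \<in> U then 0 else \<infinity>)"

text \<open>For a proper \<open>f\<close> the set below is empty wherever \<open>f x = \<infinity>\<close>, as it should be.\<close>

definition subdifferential :: "('a::real_inner \<Rightarrow> ereal) \<Rightarrow> 'a \<Rightarrow> 'a set" where
  "subdifferential f x = {s. \<forall>y. f x + ereal (s \<bullet> (y - x)) \<le> f y}"

definition gradient :: "('a::real_inner \<Rightarrow> real) \<Rightarrow> 'a \<Rightarrow> 'a" where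
  "gradient h x = (THE D. GDERIV h x :> D)"

definition scale_op :: "real \<Rightarrow> ('a::real_vector \<Rightarrow> 'a set) \<Rightarrow> 'a \<Rightarrow> 'a set" where
  "scale_op \<gamma> S x = (\<lambda>s. \<gamma> *\<^sub>R s) ` S x"

text \<open>
  The inverse of the set-valued operator \<open>I + S\<close>, read as a function. If \<open>S\<close> is maximally
  monotone, as the subdifferential of a proper closed convex function is, then by Minty's theorem
  every \<open>z\<close> has exactly one such \<open>x\<close>.
\<close>

definition resolvent :: "('a::real_vector \<Rightarrow> 'a set) \<Rightarrow> 'a \<Rightarrow> 'a" where
  "resolvent S z = (THE x. \<exists>s\<in>S x. z = x + s)"

definition three_op_splitting ::
  "real \<Rightarrow> ('a::real_vector \<Rightarrow> 'a set) \<Rightarrow> ('a \<Rightarrow> 'a set) \<Rightarrow> ('a \<Rightarrow> 'a) \<Rightarrow> 'a \<Rightarrow> 'a" where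
  "three_op_splitting \<gamma> A B C z =
     (let JA = resolvent (scale_op \<gamma> A); JB = resolvent (scale_op \<gamma> B)
      in z - JB z + JA (2 *\<^sub>R JB z - z - \<gamma> *\<^sub>R C (JB z)))"

end

theory Submission
  imports Defs
begin

text \<open>
  Put \<open>c = 1 / (1 + a)\<close>. The resolvents are \<open>P\<^sub>V\<close> and \<open>c P\<^sub>U\<close>, and \<open>C\<close> is the identity, so
  \<open>T = (I - c P\<^sub>U) P\<^sub>V\<^sub>\<bottom>\<close>. Let \<open>V\<close> be horizontal in every plane and let \<open>U\<close> be the line of slope angle
  \<open>\<theta>\<^sub>n\<close> in the \<open>n\<close>-th plane, with \<open>sin\<^sup>2 \<theta>\<^sub>n = 1 / (n + 1)\<close>. Then \<open>T\<close> multiplies the \<open>n\<close>-th vertical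
  coordinate by \<open>1 - c / (n + 1)\<close>, whose \<open>k\<close>-th power is at least \<open>1 / e\<close> for \<open>k \<le> n\<close>. Starting
  from vertical coordinates with squares \<open>F(n)\<^sup>2 - F(n+1)\<^sup>2\<close>, the blocks \<open>n \<ge> k\<close> alone contribute
  at least \<open>e\<^sup>-\<^sup>2 F(k)\<^sup>2\<close> to the squared norm of the \<open>k\<close>-th iterate, by telescoping.
\<close>

section \<open>Subgradients, resolvents and gradient in a general inner product space\<close>

text \<open>The normal cone of a subspace is its orthogonal complement, so the subgradients at
  \<open>x\<close> form \<open>a x\<close> plus that complement. The case \<open>a = 0\<close>
  serves for \<open>g\<close>.\<close>

lemma subdifferential_indicator_quadratic:
  fixes U :: "'a::real_inner set"
  assumes U: "subspace U" and a: "a \<ge> 0"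
  shows "s \<in> subdifferential (\<lambda>x. convex_indicator U x + ereal (a / 2 * (norm x)\<^sup>2)) x
    \<longleftrightarrow> x \<in> U \<and> (\<forall>u\<in>U. (s - a *\<^sub>R x) \<bullet> u = 0)"
    (is "s \<in> subdifferential ?f x \<longleftrightarrow> ?R")
proof
  assume s: "s \<in> subdifferential ?f x"
  then have le: "?f x + ereal (s \<bullet> (y - x)) \<le> ?f y" for y
    by (simp add: subdifferential_def)
  have x: "x \<in> U"
    \<comment> \<open>At \<open>0\<close>, a point of \<open>U\<close>, the function is finite, so
      it must be finite at \<open>x\<close> too.\<close>
    using le[of 0] subspace_0[OF U] by (auto simp: convex_indicator_def split: if_splits)
  have "(s - a *\<^sub>R x) \<bullet> u = 0" if u: "u \<in> U" for u
  proof -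
    define d where "d = (s - a *\<^sub>R x) \<bullet> u"
    define K where "K = a / 2 * (norm u)\<^sup>2"
    have K: "K \<ge> 0" using a by (simp add: K_def)
    have ineq: "t * d \<le> t\<^sup>2 * K" for t
    proof -
      have "x + t *\<^sub>R u \<in> U" using U x u by (simp add: subspace_add subspace_scale)
      then have "a / 2 * (norm x)\<^sup>2 + s \<bullet> (t *\<^sub>R u) \<le> a / 2 * (norm (x + t *\<^sub>R u))\<^sup>2"
        using le[of "x + t *\<^sub>R u"] x by (simp add: convex_indicator_def)
      also have "(norm (x + t *\<^sub>R u))\<^sup>2 = (norm x)\<^sup>2 + 2 * t * (x \<bullet> u) + t\<^sup>2 * (norm u)\<^sup>2"
        unfolding power2_norm_eq_inner
        by (simp add: inner_add_left inner_add_right inner_commute power2_eq_square algebra_simps)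
      finally show ?thesis by (simp add: d_def K_def inner_diff_left algebra_simps)
    qed
    \<comment> \<open>The choice \<open>t = d / (K + 1)\<close> makes the linear term exceed the
      quadratic one unless \<open>d = 0\<close>; the \<open>+ 1\<close> keeps the denominator
      positive when \<open>K = 0\<close>.\<close>
    have "d / (K + 1) * d * (K + 1)\<^sup>2 \<le> (d / (K + 1))\<^sup>2 * K * (K + 1)\<^sup>2"
      by (intro mult_right_mono ineq) simp
    moreover have "d / (K + 1) * d * (K + 1)\<^sup>2 = d\<^sup>2 * (K + 1)"
      using K by (simp add: power2_eq_square)
    moreover have "(d / (K + 1))\<^sup>2 * K * (K + 1)\<^sup>2 = d\<^sup>2 * K"
      using K by (simp add: power_divide)
    ultimately have "d\<^sup>2 * (K + 1) \<le> d\<^sup>2 * K" by simp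
    then have "d = 0" by (simp add: algebra_simps)
    then show ?thesis by (simp add: d_def)
  qed
  with x show ?R by blast
next
  assume R: ?R
  have "?f x + ereal (s \<bullet> (y - x)) \<le> ?f y" for y
  proof (cases "y \<in> U")
    case True
    \<comment> \<open>As \<open>y - x\<close> lies in \<open>U\<close>, \<open>s\<close> acts on it
      like \<open>a x\<close>. What remains is convexity of the quadratic, that is, nonnegativity of
      \<open>a / 2 * (norm (y - x))\<^sup>2\<close>.\<close>
    have "s \<bullet> (y - x) = a * (x \<bullet> (y - x))"
      using R subspace_diff[OF U True, of x] by (simp add: inner_diff_left)
    moreover have "0 \<le> a / 2 * (norm (y - x))\<^sup>2" using a by simp
    moreover have "(norm (y - x))\<^sup>2 = (norm y)\<^sup>2 - (norm x)\<^sup>2 - 2 * (x \<bullet> (y - x))"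
      by (simp add: power2_norm_eq_inner inner_diff_left inner_diff_right inner_commute)
    ultimately have "a / 2 * (norm x)\<^sup>2 + s \<bullet> (y - x) \<le> a / 2 * (norm y)\<^sup>2"
      by (simp add: algebra_simps)
    then show ?thesis using True R by (simp add: convex_indicator_def)
  qed (simp add: convex_indicator_def)
  then show "s \<in> subdifferential ?f x" by (simp add: subdifferential_def)
qed

text \<open>The value is the projection of \<open>z\<close> onto \<open>U\<close> divided by
  \<open>1 + a\<close>. It is characterized by orthogonality because a projection need not exist in
  a general inner product space; two candidates differ by a vector of \<open>U\<close> orthogonal to
  itself.\<close>

lemma resolvent_subdifferential_indicator_quadratic:
  fixes U :: "'a::real_inner set"
  assumes U: "subspace U" and a: "a \<ge> 0"
    and x: "x \<in> U" and orth: "\<And>u. u \<in> U \<Longrightarrow> (z - (1 + a) *\<^sub>R x) \<bullet> u = 0"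
  shows "resolvent (scale_op 1
    (subdifferential (\<lambda>x. convex_indicator U x + ereal (a / 2 * (norm x)\<^sup>2)))) z = x"
proof -
  have iff: "(\<exists>s\<in>scale_op 1 (subdifferential
      (\<lambda>x. convex_indicator U x + ereal (a / 2 * (norm x)\<^sup>2))) y. z = y + s)
    \<longleftrightarrow> y \<in> U \<and> (\<forall>u\<in>U. (z - (1 + a) *\<^sub>R y) \<bullet> u = 0)" (is "?L \<longleftrightarrow> ?R") for y
  proof -
    have "?L \<longleftrightarrow> z - y \<in> subdifferential
        (\<lambda>x. convex_indicator U x + ereal (a / 2 * (norm x)\<^sup>2)) y"
      by (force simp: scale_op_def image_iff)
    also have "\<dots> \<longleftrightarrow> ?R"
      unfolding subdifferential_indicator_quadratic[OF U a]
      by (simp add: scaleR_add_left diff_diff_eq)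
    finally show ?thesis .
  qed
  show ?thesis
    unfolding resolvent_def iff
  proof (rule the_equality)
    show "x \<in> U \<and> (\<forall>u\<in>U. (z - (1 + a) *\<^sub>R x) \<bullet> u = 0)" using x orth by blast
    fix y assume y: "y \<in> U \<and> (\<forall>u\<in>U. (z - (1 + a) *\<^sub>R y) \<bullet> u = 0)"
    have "x - y \<in> U" using U x y by (simp add: subspace_diff)
    then have "(z - (1 + a) *\<^sub>R y) \<bullet> (x - y) - (z - (1 + a) *\<^sub>R x) \<bullet> (x - y) = 0"
      using y orth by simp
    then have "(1 + a) * ((x - y) \<bullet> (x - y)) = 0"
      by (simp add: inner_diff_left algebra_simps)
    with a show "y = x" by simp
  qed
qed

lemma gradient_half_norm_squared: "gradient (\<lambda>x. 1 / 2 * (norm x)\<^sup>2) (x :: 'a::real_inner) = x"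
  unfolding gradient_def
proof (rule the_equality)
  show der: "GDERIV (\<lambda>x::'a. 1 / 2 * (norm x)\<^sup>2) x :> x"
    unfolding gderiv_def power2_norm_eq_inner
    by (auto intro!: derivative_eq_intros simp: inner_commute)
  fix D assume "GDERIV (\<lambda>x::'a. 1 / 2 * (norm x)\<^sup>2) x :> D"
  then have "(\<lambda>h. h \<bullet> D) = (\<lambda>h. h \<bullet> x)"
    using der has_derivative_unique unfolding gderiv_def by blast
  then have "(D - x) \<bullet> D = (D - x) \<bullet> x" by meson
  then have "(D - x) \<bullet> (D - x) = 0" by (simp add: inner_diff_right)
  then show "D = x" by simp
qed

section \<open>Blockwise lines in \<open>ell22\<close> and their projections\<close>

text \<open>For unit vectors \<open>u n\<close> this is the space of sequences whose
  \<open>n\<close>-th block lies on the line spanned by \<open>u n\<close>. Writing it as a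
  fixed-point set of continuous maps makes closedness immediate.\<close>

definition line_space :: "(nat \<Rightarrow> real^2) \<Rightarrow> ell22 set" where
  "line_space u = {x. \<forall>n. entry x n = (u n \<bullet> entry x n) *\<^sub>R u n}"

definition line_proj :: "(nat \<Rightarrow> real^2) \<Rightarrow> ell22 \<Rightarrow> ell22" where
  "line_proj u x = Abs_ell22 (\<lambda>n. (u n \<bullet> entry x n) *\<^sub>R u n)"

lemma ell22_eqI: "(\<And>n. entry x n = entry y n) \<Longrightarrow> x = y"
  by (meson entry_inject ext)

lemma bounded_linear_entry: "bounded_linear (\<lambda>x. entry x n)"
  by (rule bounded_linear_intro[where K = 1])
    (simp_all add: plus_ell22.rep_eq scaleR_ell22.rep_eq norm_entry_le)

lemma subspace_line_space: "subspace (line_space u)"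
  by (auto simp: subspace_def line_space_def zero_ell22.rep_eq plus_ell22.rep_eq
      scaleR_ell22.rep_eq inner_add_right scaleR_add_left)
    (metis scaleR_scaleR)+

lemma closed_line_space: "closed (line_space u)"
  unfolding line_space_def
  by (intro closed_Collect_all closed_Collect_eq continuous_intros
      linear_continuous_on[OF bounded_linear_entry])

lemma entry_line_proj:
  assumes "\<And>n. norm (u n) = 1"
  shows "entry (line_proj u x) n = (u n \<bullet> entry x n) *\<^sub>R u n"
proof -
  have "norm ((u n \<bullet> entry x n) *\<^sub>R u n) \<le> norm (entry x n)" for n
    using Cauchy_Schwarz_ineq2[of "u n" "entry x n"] assms by simp
  then have "summable (\<lambda>n. (norm ((u n \<bullet> entry x n) *\<^sub>R u n))\<^sup>2)"
    by (intro summable_comparison_test'[OF summable_entry[of x]]) (simp add: power_mono)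
  then show ?thesis
    by (simp add: line_proj_def Abs_ell22_inverse)
qed

lemma line_proj_in_line_space:
  assumes "\<And>n. norm (u n) = 1"
  shows "line_proj u x \<in> line_space u"
  using assms by (simp add: line_space_def entry_line_proj flip: power2_norm_eq_inner)

lemma line_proj_orthogonal:
  assumes u: "\<And>n. norm (u n) = 1" and y: "y \<in> line_space u"
  shows "(x - line_proj u x) \<bullet> y = 0"
proof -
  have "entry (x - line_proj u x) n \<bullet> entry y n = 0" for n
  proof -
    obtain r where "entry y n = r *\<^sub>R u n" using y by (auto simp: line_space_def)
    then show ?thesis
      using u[of n] by (simp add: minus_ell22.rep_eq entry_line_proj[OF u] inner_diff_left
          norm_eq_1 inner_commute[of "entry x n"])
  qed
  then show ?thesis by (simp add: inner_ell22.rep_eq)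
qed

text \<open>With \<open>C\<close> the identity and step size 1, the argument of the outer resolvent
  collapses to \<open>line_proj v z - z\<close>, the negative of the part of \<open>z\<close>
  orthogonal to \<open>line_space v\<close>.\<close>

lemma three_op_splitting_line_spaces:
  assumes a: "a \<ge> 0" and u: "\<And>n. norm (u n) = 1" and v: "\<And>n. norm (v n) = 1"
  shows "three_op_splitting 1
      (subdifferential (\<lambda>x. convex_indicator (line_space u) x + ereal (a / 2 * (norm x)\<^sup>2)))
      (subdifferential (convex_indicator (line_space v)))
      (gradient (\<lambda>x. 1 / 2 * (norm x)\<^sup>2)) z
    = z - line_proj v z - (1 / (1 + a)) *\<^sub>R line_proj u (z - line_proj v z)"
proof -
  have JB: "resolvent (scale_op 1 (subdifferential (convex_indicator (line_space v)))) z
      = line_proj v z"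
    using resolvent_subdifferential_indicator_quadratic[OF subspace_line_space, of 0
        "line_proj v z" v z] v
    by (simp add: line_proj_in_line_space line_proj_orthogonal)
  define w where "w = z - line_proj v z"
  define q where "q = - (1 / (1 + a)) *\<^sub>R line_proj u w"
  have "(- w - (1 + a) *\<^sub>R q) \<bullet> y = 0" if "y \<in> line_space u" for y
    using line_proj_orthogonal[OF u that, of w] a by (simp add: q_def inner_diff_left)
  moreover have "q \<in> line_space u"
    unfolding q_def by (intro subspace_scale subspace_line_space line_proj_in_line_space u)
  ultimately have JA: "resolvent (scale_op 1 (subdifferential
      (\<lambda>x. convex_indicator (line_space u) x + ereal (a / 2 * (norm x)\<^sup>2)))) (- w) = q"
    by (intro resolvent_subdifferential_indicator_quadratic subspace_line_space a)
  have "2 *\<^sub>R line_proj v z - z - 1 *\<^sub>R line_proj v z = - w"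
    by (simp add: w_def scaleR_2)
  then show ?thesis
    unfolding three_op_splitting_def Let_def JB gradient_half_norm_squared
    by (simp only: JA) (simp add: w_def q_def)
qed

section \<open>Estimates in one plane, for one factor, and for a series of powers\<close>

lemma norm_vec2_squared: "(norm (x :: real^2))\<^sup>2 = (x $ 1)\<^sup>2 + (x $ 2)\<^sup>2"
  unfolding power2_norm_eq_inner by (simp add: inner_vec_def sum_2 power2_eq_square)

text \<open>Subtracting \<open>c\<close> times a projection, with \<open>c\<close> in
  \<open>[0, 1]\<close>, does not increase the norm. This controls both coordinates of a block of
  \<open>T z\<close> by the vertical coordinate of that block of \<open>z\<close>.\<close>

lemma vertical_bounds_norm:
  fixes w u :: "real^2"
  assumes "w $ 1 = 0" "norm u = 1" "0 \<le> c" "c \<le> 1"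
  shows "(norm (w - c *\<^sub>R ((u \<bullet> w) *\<^sub>R u)))\<^sup>2 \<le> (w $ 2)\<^sup>2"
proof -
  have "(norm (w - c *\<^sub>R ((u \<bullet> w) *\<^sub>R u)))\<^sup>2 = (norm w)\<^sup>2 - (2 * c - c\<^sup>2) * (u \<bullet> w)\<^sup>2"
    using assms(2) unfolding power2_norm_eq_inner norm_eq_1
    by (simp add: inner_diff_left inner_diff_right inner_commute power2_eq_square algebra_simps)
  moreover have "0 \<le> (2 * c - c\<^sup>2) * (u \<bullet> w)\<^sup>2"
  proof -
    have "0 \<le> c * (2 - c)" using assms by simp
    then have "0 \<le> 2 * c - c\<^sup>2" by (simp add: power2_eq_square algebra_simps)
    then show ?thesis by simp
  qed
  ultimately show ?thesis using assms(1) by (simp add: norm_vec2_squared)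
qed

text \<open>For positive \<open>n\<close>, \<open>1 - 1 / (n + 1)\<close> is the inverse of
  \<open>1 + 1 / n\<close>, hence at least \<open>exp (- 1 / n)\<close>, and
  \<open>k / n \<le> 1\<close>. For \<open>n = 0\<close> only the empty power \<open>k = 0\<close>
  occurs.\<close>

lemma one_minus_inverse_Suc_power_ge_exp:
  assumes "k \<le> n" "0 \<le> c" "c \<le> 1"
  shows "exp (- 1) \<le> (1 - c / real (Suc n)) ^ k"
proof (cases "n = 0")
  case False
  have "1 + 1 / real n \<le> exp (1 / real n)" by (rule exp_ge_add_one_self)
  then have "inverse (exp (1 / real n)) \<le> inverse (1 + 1 / real n)"
    by (rule le_imp_inverse_le) (simp add: add_pos_nonneg)
  also have "inverse (1 + 1 / real n) = 1 - 1 / real (Suc n)"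
    using False by (simp add: field_simps)
  also have "\<dots> \<le> 1 - c / real (Suc n)" using assms by (simp add: divide_right_mono)
  finally have "exp (- (1 / real n)) ^ k \<le> (1 - c / real (Suc n)) ^ k"
    by (intro power_mono) (simp_all add: exp_minus)
  moreover have "exp (- (1 / real n)) ^ k = exp (- (real k / real n))"
    by (simp flip: exp_of_nat_mult)
  moreover have "exp (- 1) \<le> exp (- (real k / real n))" using assms False by simp
  ultimately show ?thesis by linarith
qed (use assms in simp)

text \<open>Dominated convergence for series with majorant \<open>p\<close>. The ratios may
  accumulate at 1, so there need be no common geometric rate.\<close>

lemma suminf_geometric_weights_tendsto_0:
  fixes p r :: "nat \<Rightarrow> real"
  assumes p: "summable p" "\<And>n. p n \<ge> 0" and r: "\<And>n. 0 \<le> r n" "\<And>n. r n < 1"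
  shows "(\<lambda>k. \<Sum>n. p n * r n ^ k) \<longlonglongrightarrow> 0"
proof -
  have "(\<lambda>k. p n * r n ^ k) \<longlonglongrightarrow> 0" for n
    using r by (intro tendsto_mult_right_zero LIMSEQ_realpow_zero) auto
  moreover have "norm (p n * r n ^ k) \<le> p n" for n k
    using p(2) r(1) less_imp_le[OF r(2)] by (simp add: abs_mult power_le_one mult_left_le)
  then have "\<forall>\<^sub>F (n, k) in at_top \<times>\<^sub>F sequentially. norm (p n * r n ^ k) \<le> p n"
    by (intro always_eventually) auto
  ultimately have "(\<lambda>k. \<Sum>n. p n * r n ^ k) \<longlonglongrightarrow> (\<Sum>n::nat. 0)"
    by (rule tannerys_theorem[THEN conjunct2, THEN conjunct2, OF _ _ p(1) sequentially_bot])
  then show ?thesis by simp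
qed

section \<open>The subspaces, the starting point and the two-sided control of the iterates\<close>

theorem theoremD7:
  fixes a :: real and F :: "real \<Rightarrow> real"
  assumes "a \<ge> 0"
    and "\<And>t. t \<ge> 0 \<Longrightarrow> F t \<in> {0<..<1}"
    and "strict_antimono_on {0..} F"
    and "(F \<longlongrightarrow> 0) at_top"
  shows "\<exists>(z0 :: ell22) U V.
    subspace U \<and> closed U \<and> subspace V \<and> closed V \<and> U \<inter> V = {0} \<and>
    (let f = (\<lambda>x. convex_indicator U x + ereal (a / 2 * (norm x)\<^sup>2));
         g = convex_indicator V;
         h = (\<lambda>x :: ell22. 1 / 2 * (norm x)\<^sup>2);
         A = subdifferential f;
         B = subdifferential g;
         C = gradient h;
         T = three_op_splitting 1 A B C
     in {z. T z = z} = {0} \<and>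
        (\<forall>z :: nat \<Rightarrow> ell22. z 0 = z0 \<and> (\<forall>k. z (Suc k) = T (z k)) \<longrightarrow>
          (\<forall>k. norm (z k - 0) \<ge> exp (- 1) * F (real k)) \<and>
          (\<lambda>j. norm (z j - 0)) \<longlonglongrightarrow> 0))"
proof -
  define c where "c = 1 / (1 + a)"
  have c: "0 < c" "c \<le> 1" using assms(1) by (auto simp: c_def)
  define s where "s n = sqrt (1 / real (Suc n))" for n
  have s2: "(s n)\<^sup>2 = 1 / real (Suc n)" for n by (simp add: s_def)
  \<comment> \<open>Nonzero sines keep the two lines of each plane distinct, which gives the trivial
    intersection.\<close>
  have s0: "s n \<noteq> 0" for n by (simp add: s_def)
  define u :: "nat \<Rightarrow> real^2" where "u n = vector [sqrt (1 - (s n)\<^sup>2), s n]" for n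
  define v :: "nat \<Rightarrow> real^2" where "v n = vector [1, 0]" for n
  have "(s n)\<^sup>2 \<le> 1" for n by (simp add: s2)
  then have u: "norm (u n) = 1" for n
    unfolding norm_eq_1 by (simp add: u_def inner_vec_def sum_2 flip: power2_eq_square)
  have v: "norm (v n) = 1" for n
    unfolding norm_eq_1 by (simp add: v_def inner_vec_def sum_2)
  define U where "U = line_space u"
  define V where "V = line_space v"
  define T where "T = three_op_splitting 1
      (subdifferential (\<lambda>x. convex_indicator U x + ereal (a / 2 * (norm x)\<^sup>2)))
      (subdifferential (convex_indicator V)) (gradient (\<lambda>x :: ell22. 1 / 2 * (norm x)\<^sup>2))"
  define r where "r n = 1 - c / real (Suc n)" for n
  \<comment> \<open>Equality on the left does occur: \<open>r 0 = 0\<close> when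
    \<open>a = 0\<close>.\<close>
  have r: "0 \<le> r n" "r n < 1" for n
    using c by (auto simp: r_def field_simps)
  have T: "T z = z - line_proj v z - c *\<^sub>R line_proj u (z - line_proj v z)" for z
    unfolding T_def U_def V_def c_def by (intro three_op_splitting_line_spaces assms(1) u v)
  define w where "w z n = entry (z - line_proj v z) n" for z n
  have entry_T: "entry (T z) n = w z n - c *\<^sub>R ((u n \<bullet> w z n) *\<^sub>R u n)" for z n
    unfolding T minus_ell22.rep_eq[of "z - line_proj v z"] scaleR_ell22.rep_eq
      entry_line_proj[OF u] w_def ..
  have w: "w z n $ 1 = 0" "w z n $ 2 = entry z n $ 2" for z n
    by (simp_all add: w_def minus_ell22.rep_eq entry_line_proj[OF v] v_def inner_vec_def sum_2)
  have T2: "entry (T z) n $ 2 = r n * entry z n $ 2" for z n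
  proof -
    have "entry (T z) n $ 2 = (1 - c * (s n)\<^sup>2) * entry z n $ 2"
      by (simp add: entry_T w u_def inner_vec_def sum_2 power2_eq_square algebra_simps)
    then show ?thesis by (simp add: s2 r_def)
  qed
  have norm_T: "(norm (entry (T z) n))\<^sup>2 \<le> (entry z n $ 2)\<^sup>2" for z n
    using vertical_bounds_norm[OF w(1) u, of c] c by (simp add: entry_T w(2))

  have "x = 0" if "x \<in> U" "x \<in> V" for x
  proof (rule ell22_eqI)
    fix n
    have x: "entry x n = (u n \<bullet> entry x n) *\<^sub>R u n" "entry x n = (v n \<bullet> entry x n) *\<^sub>R v n"
      using that by (auto simp: U_def V_def line_space_def)
    have "entry x n $ 2 = 0" by (subst x(2)) (simp add: v_def)
    moreover have "entry x n $ 2 = (u n \<bullet> entry x n) * s n" by (subst x(1)) (simp add: u_def)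
    ultimately have "u n \<bullet> entry x n = 0" using s0 by simp
    with x(1) show "entry x n = entry 0 n" by (simp add: zero_ell22.rep_eq)
  qed
  then have UV: "U \<inter> V = {0}"
    using subspace_0[OF subspace_line_space] by (auto simp: U_def V_def)

  have "z = 0" if "T z = z" for z
  proof (rule ell22_eqI)
    fix n
    \<comment> \<open>A factor below 1 forces the vertical coordinate of a fixed point to vanish;
      \<open>norm_T\<close> then kills the whole block.\<close>
    have "entry z n $ 2 = r n * entry z n $ 2" using T2[of z n] that by simp
    then have "entry z n $ 2 = 0" using r[of n] by simp
    then show "entry z n = entry 0 n" using norm_T[of z n] that by (simp add: zero_ell22.rep_eq)
  qed
  moreover have "T 0 = 0"
  proof (rule ell22_eqI)
    show "entry (T 0) n = entry 0 n" for n
      using norm_T[of 0 n] by (simp add: zero_ell22.rep_eq)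
  qed
  ultimately have fix_T: "{z. T z = z} = {0}" by blast

  define p where "p n = (F (real n))\<^sup>2 - (F (real (Suc n)))\<^sup>2" for n
  have F0: "F (real n) > 0" for n using assms(2)[of "real n"] by simp
  have "F (real (Suc n)) < F (real n)" for n
    using assms(3) by (auto simp: monotone_on_def)
  then have p0: "p n \<ge> 0" for n
    using F0[of "Suc n"] by (simp add: p_def power_mono less_imp_le)
  have lim: "(\<lambda>n. (F (real n))\<^sup>2) \<longlonglongrightarrow> 0"
    using tendsto_power[OF filterlim_compose[OF assms(4) filterlim_real_sequentially], of 2]
    by simp
  have p_sums: "(\<lambda>n. p (n + k)) sums (F (real k))\<^sup>2" for k
    using telescope_sums'[OF LIMSEQ_ignore_initial_segment[OF lim, of k]] by (simp add: p_def)
  have p_summable: "summable p" using p_sums[of 0] by (simp add: sums_iff)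

  define z0 where "z0 = Abs_ell22 (\<lambda>n. vector [0, sqrt (p n)])"
  have "(norm (vector [0, sqrt (p n)] :: real^2))\<^sup>2 = p n" for n
    using p0 by (simp add: norm_vec2_squared)
  then have z0: "entry z0 n = vector [0, sqrt (p n)]" for n
    using p_summable by (simp add: z0_def Abs_ell22_inverse)

  have iterates: "(\<forall>k. norm (z k - 0) \<ge> exp (- 1) * F (real k)) \<and> (\<lambda>j. norm (z j - 0)) \<longlonglongrightarrow> 0"
    if z: "z 0 = z0" "\<And>k. z (Suc k) = T (z k)" for z
  proof
    \<comment> \<open>The vertical coordinates obey a recursion of their own, so the horizontal
      ones, in general nonzero after the first step, need no formula.\<close>
    have "entry (z k) n $ 2 = r n ^ k * sqrt (p n)" for k n
      by (induction k) (simp_all add: z z0 T2)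
    then have z2: "(entry (z k) n $ 2)\<^sup>2 = p n * (r n)\<^sup>2 ^ k" for k n
      using p0 by (simp add: power_mult_distrib mult.commute flip: power_mult)
    have r2: "0 \<le> (r n)\<^sup>2" "(r n)\<^sup>2 < 1" for n
      using r[of n] by (simp_all add: power_less_one_iff)
    have lower: "p n * (r n)\<^sup>2 ^ k \<le> (norm (entry (z k) n))\<^sup>2" for k n
      by (simp add: norm_vec2_squared flip: z2)
    show "\<forall>k. norm (z k - 0) \<ge> exp (- 1) * F (real k)"
    proof
      fix k
      have "(exp (- 1) * F (real k))\<^sup>2 = (\<Sum>n. (exp (- 1))\<^sup>2 * p (n + k))"
        using sums_mult[OF p_sums, of "(exp (- 1))\<^sup>2" k] by (simp add: sums_iff power_mult_distrib)
      \<comment> \<open>The shift to blocks \<open>n + k\<close> restricts the sum to indices of at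
        least \<open>k\<close>, where the \<open>k\<close>-th power of the factor is still at least
        \<open>exp (- 1)\<close>.\<close>
      also have "\<dots> \<le> (\<Sum>n. (norm (entry (z k) (n + k)))\<^sup>2)"
      proof (rule suminf_le)
        fix n
        have "exp (- 1) \<le> r (n + k) ^ k"
          unfolding r_def using c by (intro one_minus_inverse_Suc_power_ge_exp) auto
        then have "(exp (- 1))\<^sup>2 \<le> (r (n + k) ^ k)\<^sup>2" by (intro power_mono) auto
        then have "(exp (- 1))\<^sup>2 * p (n + k) \<le> p (n + k) * (r (n + k))\<^sup>2 ^ k"
          using p0[of "n + k"] by (simp add: mult.commute mult_left_mono flip: power_mult)
        also have "\<dots> \<le> (norm (entry (z k) (n + k)))\<^sup>2" by (rule lower)
        finally show "(exp (- 1))\<^sup>2 * p (n + k) \<le> (norm (entry (z k) (n + k)))\<^sup>2" .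
      next
        show "summable (\<lambda>n. (exp (- 1))\<^sup>2 * p (n + k))"
          using p_sums[of k] by (intro summable_mult) (simp add: sums_iff)
        show "summable (\<lambda>n. (norm (entry (z k) (n + k)))\<^sup>2)"
          by (subst summable_iff_shift) (rule summable_entry)
      qed
      also have "\<dots> \<le> (norm (z k))\<^sup>2"
        using suminf_split_initial_segment[OF summable_entry[of "z k"], of k]
        by (simp add: norm_ell22_eq sum_nonneg)
      finally have "exp (- 1) * F (real k) \<le> norm (z k)"
        by (rule power2_le_imp_le) simp
      then show "norm (z k - 0) \<ge> exp (- 1) * F (real k)" by simp
    qed
    have summable: "summable (\<lambda>n. p n * (r n)\<^sup>2 ^ k)" for k
      using lower[of _ k] p0
      by (intro summable_comparison_test'[OF summable_entry[of "z k"]]) (simp add: abs_mult)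
    \<comment> \<open>The index moves by one because \<open>norm_T\<close> bounds the full blocks of
      an iterate by the vertical coordinates of its predecessor.\<close>
    have "(norm (z (Suc k)))\<^sup>2 \<le> (\<Sum>n. p n * (r n)\<^sup>2 ^ k)" for k
      unfolding norm_ell22_eq z2[symmetric] z(2)
      by (intro suminf_le norm_T summable_entry) (use summable[of k] in \<open>simp add: z2\<close>)
    then have "(\<lambda>k. (norm (z (Suc k)))\<^sup>2) \<longlonglongrightarrow> 0"
      by (intro tendsto_sandwich[OF _ _ tendsto_const
            suminf_geometric_weights_tendsto_0[of p "\<lambda>n. (r n)\<^sup>2", OF p_summable p0 r2]])
        auto
    then have "(\<lambda>k. sqrt ((norm (z (Suc k)))\<^sup>2)) \<longlonglongrightarrow> sqrt 0" by (rule tendsto_real_sqrt)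
    then have "(\<lambda>k. norm (z (Suc k))) \<longlonglongrightarrow> 0" by simp
    then show "(\<lambda>j. norm (z j - 0)) \<longlonglongrightarrow> 0"
      unfolding diff_zero by (rule LIMSEQ_imp_Suc)
  qed

  have "{z. T z = z} = {0} \<and>
      (\<forall>z. z 0 = z0 \<and> (\<forall>k. z (Suc k) = T (z k)) \<longrightarrow>
        (\<forall>k. norm (z k - 0) \<ge> exp (- 1) * F (real k)) \<and> (\<lambda>j. norm (z j - 0)) \<longlonglongrightarrow> 0)"
    using fix_T iterates by blast
  moreover have "subspace U" "closed U" "subspace V" "closed V"
    by (simp_all add: U_def V_def subspace_line_space closed_line_space)
  ultimately show ?thesis
    unfolding Let_def T_def
    by (intro exI[of _ z0] exI[of _ U] exI[of _ V] conjI UV) (elim conjE, assumption)+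
qed

end
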